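(* Let $K\ge 2$ be an integer and let $\mathcal{X}=\{x_1,\ldots,x_N\}$ be a finite collection of positive real numbers sorted so that $x_1\le\cdots\le x_N$. The following algorithm can be implemented to run in $O(N\log N)$ time: (1) Set $\mathcal{X}_1=\mathcal{X}$, $\mathcal{X}_k=\emptyset$ for $2\le k\le K$, $\mathcal{K}=\{1,\ldots,K\}$; $S_k=\sum_{x\in\mathcal{X}_k}x$ denotes the current set sums. (2) If $|\mathcal{K}|=1$, stop. (3) Let $i\in\mathcal{K}$ index a set with the largest sum among the sets indexed by $\mathcal{K}$. (4) Let $j\in\arg\min_k S_k$. (5) Let $\mathcal{X}_*=\{x\in\mathcal{X}_i:|(S_i-x)-(S_j+x)|<|S_i-S_j|\}$. (6) If $\mathcal{X}_*=\emptyset$, set $\mathcal{K}\leftarrow\mathcal{K}\setminus\{i\}$ and go to (2); otherwise let $x_*=\max\mathcal{X}_*$. (7) Move $x_*$ from $\mathcal{X}_i$ to $\mathcal{X}_j$, update sums, go to (2). *)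

theory Defs
  imports Complex_Main "HOL-Library.Multiset" "HOL-Library.Landau_Symbols"
begin

section \<open>The partitioning algorithm\<close>

text \<open>
  A state consists of the sets \<open>X\<^sub>1, \<dots>, X\<^sub>K\<close> (multisets, because the given numbers need not be
  distinct) and the index set called \<open>I\<close> here.  Values of the first component outside
  \<open>{1..K}\<close> are irrelevant.
\<close>

type_synonym state = "(nat \<Rightarrow> real multiset) \<times> nat set"

definition set_sum :: "(nat \<Rightarrow> real multiset) \<Rightarrow> nat \<Rightarrow> real" where
  "set_sum X k = (\<Sum>x\<in>#X k. x)"

definition improving :: "(nat \<Rightarrow> real multiset) \<Rightarrow> nat \<Rightarrow> nat \<Rightarrow> real set" where
  "improving X i j =
     {x. x \<in># X i \<and>
         \<bar>(set_sum X i - x) - (set_sum X j + x)\<bar> < \<bar>set_sum X i - set_sum X j\<bar>}"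

definition init_state :: "nat \<Rightarrow> real list \<Rightarrow> state" where
  "init_state K xs = ((\<lambda>k. if k = 1 then mset xs else {#}), {1..K})"

definition stopped :: "state \<Rightarrow> bool" where
  "stopped s \<longleftrightarrow> card (snd s) = 1"

text \<open>
  One pass through the loop body.  Ties for the largest and for the smallest sum are left open,
  hence a relation.  The smallest sum is taken over all \<open>K\<close> sets, the largest one only over the
  sets indexed by \<open>I\<close>.
\<close>

inductive alg_step :: "nat \<Rightarrow> state \<Rightarrow> state \<Rightarrow> bool" for K :: nat where
  discard:
    "\<lbrakk> \<not> stopped (X, I);
       is_arg_max (set_sum X) (\<lambda>k. k \<in> I) i;
       is_arg_min (set_sum X) (\<lambda>k. k \<in> {1..K}) j;
       improving X i j = {} \<rbrakk>
     \<Longrightarrow> alg_step K (X, I) (X, I - {i})"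
| move:
    "\<lbrakk> \<not> stopped (X, I);
       is_arg_max (set_sum X) (\<lambda>k. k \<in> I) i;
       is_arg_min (set_sum X) (\<lambda>k. k \<in> {1..K}) j;
       improving X i j \<noteq> {};
       x = Max (improving X i j) \<rbrakk>
     \<Longrightarrow> alg_step K (X, I) (X(i := X i - {#x#}, j := add_mset x (X j)), I)"


section \<open>Real RAM\<close>

text \<open>
  The usual uniform-cost real RAM: integer registers and arrays used for counting and addressing
  (with addition and truncated subtraction only), real registers and arrays with exact field
  operations and comparisons, and no conversion from reals to integers.  A program has finitely
  many instructions and therefore uses finitely many registers and arrays; array names are
  static, array indices are taken from integer registers.  Jump targets are absolute positions
  in the program, and leaving the program means halting.
\<close>

datatype instr =
    IConst nat nat          \<comment> \<open>target, constant\<close>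
  | ICopy nat nat
  | IAdd nat nat nat        \<comment> \<open>target, operands\<close>
  | ISub nat nat nat
  | ILoad nat nat nat       \<comment> \<open>target, array, index register\<close>
  | IStore nat nat nat      \<comment> \<open>array, index register, source\<close>
  | RConst nat int
  | RCopy nat nat
  | RAdd nat nat nat
  | RSub nat nat nat
  | RMul nat nat nat
  | RDiv nat nat nat
  | RLoad nat nat nat
  | RStore nat nat nat
  | Jump nat
  | IJumpLess nat nat nat   \<comment> \<open>compared registers, jump target\<close>
  | IJumpEq nat nat nat
  | RJumpLess nat nat nat
  | RJumpEq nat nat nat

type_synonym program = "instr list"

record config =
  pc :: nat
  ireg :: "nat \<Rightarrow> nat"
  rreg :: "nat \<Rightarrow> real"
  iarr :: "nat \<Rightarrow> nat \<Rightarrow> nat"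
  rarr :: "nat \<Rightarrow> nat \<Rightarrow> real"

definition next_pc :: "config \<Rightarrow> config" where
  "next_pc c = c\<lparr>pc := Suc (pc c)\<rparr>"

definition set_ireg :: "nat \<Rightarrow> nat \<Rightarrow> config \<Rightarrow> config" where
  "set_ireg r v c = c\<lparr>ireg := (ireg c)(r := v)\<rparr>"

definition set_rreg :: "nat \<Rightarrow> real \<Rightarrow> config \<Rightarrow> config" where
  "set_rreg r v c = c\<lparr>rreg := (rreg c)(r := v)\<rparr>"

definition set_iarr :: "nat \<Rightarrow> nat \<Rightarrow> nat \<Rightarrow> config \<Rightarrow> config" where
  "set_iarr a p v c = c\<lparr>iarr := (iarr c)(a := (iarr c a)(p := v))\<rparr>"

definition set_rarr :: "nat \<Rightarrow> nat \<Rightarrow> real \<Rightarrow> config \<Rightarrow> config" where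
  "set_rarr a p v c = c\<lparr>rarr := (rarr c)(a := (rarr c a)(p := v))\<rparr>"

definition jump_if :: "bool \<Rightarrow> nat \<Rightarrow> config \<Rightarrow> config" where
  "jump_if b l c = (if b then c\<lparr>pc := l\<rparr> else next_pc c)"

fun exec_instr :: "instr \<Rightarrow> config \<Rightarrow> config" where
  "exec_instr (IConst r n) c = next_pc (set_ireg r n c)"
| "exec_instr (ICopy r a) c = next_pc (set_ireg r (ireg c a) c)"
| "exec_instr (IAdd r a b) c = next_pc (set_ireg r (ireg c a + ireg c b) c)"
| "exec_instr (ISub r a b) c = next_pc (set_ireg r (ireg c a - ireg c b) c)"
| "exec_instr (ILoad r A p) c = next_pc (set_ireg r (iarr c A (ireg c p)) c)"
| "exec_instr (IStore A p a) c = next_pc (set_iarr A (ireg c p) (ireg c a) c)"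
| "exec_instr (RConst r z) c = next_pc (set_rreg r (of_int z) c)"
| "exec_instr (RCopy r a) c = next_pc (set_rreg r (rreg c a) c)"
| "exec_instr (RAdd r a b) c = next_pc (set_rreg r (rreg c a + rreg c b) c)"
| "exec_instr (RSub r a b) c = next_pc (set_rreg r (rreg c a - rreg c b) c)"
| "exec_instr (RMul r a b) c = next_pc (set_rreg r (rreg c a * rreg c b) c)"
| "exec_instr (RDiv r a b) c = next_pc (set_rreg r (rreg c a / rreg c b) c)"
| "exec_instr (RLoad r A p) c = next_pc (set_rreg r (rarr c A (ireg c p)) c)"
| "exec_instr (RStore A p a) c = next_pc (set_rarr A (ireg c p) (rreg c a) c)"
| "exec_instr (Jump l) c = c\<lparr>pc := l\<rparr>"
| "exec_instr (IJumpLess a b l) c = jump_if (ireg c a < ireg c b) l c"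
| "exec_instr (IJumpEq a b l) c = jump_if (ireg c a = ireg c b) l c"
| "exec_instr (RJumpLess a b l) c = jump_if (rreg c a < rreg c b) l c"
| "exec_instr (RJumpEq a b l) c = jump_if (rreg c a = rreg c b) l c"

definition halted :: "program \<Rightarrow> config \<Rightarrow> bool" where
  "halted P c \<longleftrightarrow> length P \<le> pc c"

definition ram_step :: "program \<Rightarrow> config \<Rightarrow> config" where
  "ram_step P c = (if halted P c then c else exec_instr (P ! pc c) c)"

text \<open>
  The input: \<open>N\<close> in integer register 0, the numbers \<open>x\<^sub>1, \<dots>, x\<^sub>N\<close> in cells \<open>0, \<dots>, N - 1\<close> of real
  array 0, everything else zero.
\<close>

definition init_config :: "real list \<Rightarrow> config" where
  "init_config xs =
     \<lparr>pc = 0,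
      ireg = (\<lambda>_. 0)(0 := length xs),
      rreg = (\<lambda>_. 0),
      iarr = (\<lambda>_ _. 0),
      rarr = (\<lambda>_ _. 0)(0 := (\<lambda>p. if p < length xs then xs ! p else 0))\<rparr>"

definition config_at :: "program \<Rightarrow> real list \<Rightarrow> nat \<Rightarrow> config" where
  "config_at P xs t = (ram_step P ^^ t) (init_config xs)"


section \<open>Implementations and their running time\<close>

text \<open>
  How a state of the algorithm is laid out in memory: cell \<open>p\<close> of integer array 0 holds the index
  of the set containing the \<open>p\<close>-th input number, integer array 1 is the characteristic
  function of \<open>I\<close>, and real array 1 holds the current set sums.  A program may use all other
  registers and arrays freely for further data structures.
\<close>

definition represents :: "nat \<Rightarrow> real list \<Rightarrow> config \<Rightarrow> state \<Rightarrow> bool" where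
  "represents K xs c s \<longleftrightarrow>
     (\<forall>p < length xs. iarr c 0 p \<in> {1..K}) \<and>
     (\<forall>k \<in> {1..K}. fst s k = image_mset (\<lambda>p. xs ! p) (mset_set {p. p < length xs \<and> iarr c 0 p = k})) \<and>
     (\<forall>k \<in> {1..K}. iarr c 1 k = (if k \<in> snd s then 1 else 0)) \<and>
     (\<forall>k \<in> {1..K}. rarr c 1 k = set_sum (fst s) k)"

text \<open>
  On input \<open>xs\<close> the program carries out the algorithm within \<open>t\<close> instructions: there is a complete
  run \<open>\<sigma> 0, \<dots>, \<sigma> m\<close> of the algorithm whose states appear in memory, in this order, at times
  \<open>\<tau> 0 < \<dots> < \<tau> m \<le> t\<close>, and the program has halted at time \<open>\<tau> m\<close>.
\<close>

definition implements_within :: "program \<Rightarrow> nat \<Rightarrow> real list \<Rightarrow> nat \<Rightarrow> bool" where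
  "implements_within P K xs t \<longleftrightarrow>
     (\<exists>(m::nat) \<sigma> \<tau>.
        \<sigma> 0 = init_state K xs \<and>
        (\<forall>r < m. alg_step K (\<sigma> r) (\<sigma> (Suc r))) \<and>
        stopped (\<sigma> m) \<and>
        (\<forall>r < m. \<tau> r < \<tau> (Suc r)) \<and>
        (\<forall>r \<le> m. represents K xs (config_at P xs (\<tau> r)) (\<sigma> r)) \<and>
        halted P (config_at P xs (\<tau> m)) \<and>
        \<tau> m \<le> t)"

end

theory Submission
  imports Defs
begin

text \<open>
  For positive numbers, an item \<open>x\<close> of set \<open>i\<close> is improving iff \<open>x < S\<^sub>i - S\<^sub>j\<close>.  Suppose all moves
  so far started from set 1.  The gap \<open>S\<^sub>1 - min S\<close> never increases, so the items were moved in
  nonincreasing order.  Hence, for \<open>k \<noteq> 1\<close>, the item \<open>x\<close> that entered set \<open>k\<close> last is its smallest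
  one, and \<open>S\<^sub>k - x\<close> was the minimal sum at that time.  As the minimal sum never decreases,
  \<open>S\<^sub>k - min S \<le> x\<close> from then on, so set \<open>k\<close> has no improving item and is discarded as soon as
  it is selected.  All moves therefore start from set 1, and the candidate item is found by one
  pointer running downwards through the sorted input.  As \<open>K\<close> is constant, this takes
  time \<open>O(N)\<close>.
\<close>

declare One_nat_def [simp del]

section \<open>The algorithm on index assignments\<close>

text \<open>The assignment \<open>a\<close> is read off integer array 0, so that a memory
  configuration determines the multisets required by \<open>represents\<close>.\<close>

definition items :: "real list \<Rightarrow> (nat \<Rightarrow> nat) \<Rightarrow> nat \<Rightarrow> real multiset" where
  "items xs a k = image_mset ((!) xs) (mset_set {q. q < length xs \<and> a q = k})"

lemma mem_items: "y \<in># items xs a k \<longleftrightarrow> (\<exists>q<length xs. a q = k \<and> y = xs ! q)"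
  by (auto simp: items_def)

lemma items_all_one:
  assumes "\<forall>q<length xs. a q = 1"
  shows "items xs a = (\<lambda>k. if k = 1 then mset xs else {#})"
proof
  fix k
  have "mset (map ((!) xs) [0..<length xs]) = mset xs"
    by (simp only: map_nth)
  moreover have "{q. q < length xs} = {0..<length xs}"
    by auto
  moreover have "{q. q < length xs \<and> a q = k} = (if k = 1 then {q. q < length xs} else {})"
    using assms by auto
  ultimately show "items xs a k = (if k = 1 then mset xs else {#})"
    by (simp add: items_def)
qed

text \<open>Stated as an equality of functions, because the right-hand side is literally the
  successor state in \<open>alg_step.move\<close>.\<close>

lemma items_move:
  assumes "q < length xs" "a q = i" "i \<noteq> j"
  shows "items xs (a(q := j)) =
           (items xs a)(i := items xs a i - {#xs ! q#}, j := add_mset (xs ! q) (items xs a j))"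
proof
  fix k
  have i: "{r. r < length xs \<and> a r = i} = insert q {r. r < length xs \<and> (a(q := j)) r = i}"
    and j: "{r. r < length xs \<and> (a(q := j)) r = j} = insert q {r. r < length xs \<and> a r = j}"
    using assms by auto
  have other: "{r. r < length xs \<and> (a(q := j)) r = k} = {r. r < length xs \<and> a r = k}"
    if "k \<noteq> i" "k \<noteq> j"
    using that assms by auto
  have "items xs a i = add_mset (xs ! q) (items xs (a(q := j)) i)"
    unfolding items_def i using assms by simp
  moreover have "items xs (a(q := j)) j = add_mset (xs ! q) (items xs a j)"
    unfolding items_def j using assms by simp
  moreover have "items xs (a(q := j)) k = items xs a k" if "k \<noteq> i" "k \<noteq> j"
    unfolding items_def other[OF that] ..
  ultimately show "items xs (a(q := j)) k =
      ((items xs a)(i := items xs a i - {#xs ! q#}, j := add_mset (xs ! q) (items xs a j))) k"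
    using assms by auto
qed

lemma set_sum_items_move:
  assumes "q < length xs" "a q = i" "i \<noteq> j"
  shows "set_sum (items xs (a(q := j))) k =
           (if k = i then set_sum (items xs a) i - xs ! q
            else if k = j then set_sum (items xs a) j + xs ! q else set_sum (items xs a) k)"
proof -
  have "xs ! q \<in># items xs a i"
    using assms by (auto simp: mem_items)
  then have "items xs a i = add_mset (xs ! q) (items xs a i - {#xs ! q#})"
    by simp
  then have "set_sum (items xs a) i = xs ! q + (\<Sum>x\<in>#items xs a i - {#xs ! q#}. x)"
    unfolding set_sum_def by (metis image_mset_add_mset sum_mset.add_mset)
  then show ?thesis
    unfolding items_move[of q xs a i j, OF assms] using assms(3) by (simp add: set_sum_def)
qed

text \<open>This makes \<open>- 1\<close> a valid initial value for the maximum in the selection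
  loop.\<close>

lemma set_sum_items_nonneg:
  assumes "\<forall>x\<in>set xs. 0 < x"
  shows "0 \<le> set_sum (items xs a) k"
proof -
  have "0 \<le> xs ! q" if "q < length xs" for q
    using assms nth_mem[OF that] by force
  then show ?thesis
    by (auto simp: set_sum_def items_def sum_unfold_sum_mset[symmetric] image_mset.compositionality
        intro!: sum_nonneg)
qed

text \<open>With \<open>d = set_sum X i - set_sum X j\<close>, nonnegative by assumption, the test
  reads \<open>\<bar>d - 2 * x\<bar> < d\<close>, that is \<open>0 < x < d\<close>.\<close>

lemma improving_iff:
  assumes "set_sum X j \<le> set_sum X i" "\<forall>y\<in>#X i. 0 < y"
  shows "x \<in> improving X i j \<longleftrightarrow> x \<in># X i \<and> x < set_sum X i - set_sum X j"
  using assms by (auto simp: improving_def abs_if)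

text \<open>
  All items at positions below \<open>p\<close> are still in set 1, those of set 1 from \<open>p\<close> on are too
  large ever to be moved, and no item outside of set 1 can ever be moved again.
\<close>

definition frontier :: "nat \<Rightarrow> real list \<Rightarrow> (nat \<Rightarrow> nat) \<Rightarrow> nat \<Rightarrow> bool" where
  "frontier K xs a p \<longleftrightarrow>
     p \<le> length xs \<and> (\<forall>q<p. a q = 1) \<and> (\<forall>q<length xs. a q \<in> {1..K}) \<and>
     (\<forall>q l. p \<le> q \<and> q < length xs \<and> a q = 1 \<and> l \<in> {1..K} \<longrightarrow>
        set_sum (items xs a) 1 - set_sum (items xs a) l \<le> xs ! q) \<and>
     (\<forall>q l. q < length xs \<and> a q \<noteq> 1 \<and> l \<in> {1..K} \<longrightarrow>
        set_sum (items xs a) (a q) - xs ! q \<le> set_sum (items xs a) l)"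

text \<open>Set \<open>j\<close> has the minimal sum, so the item at \<open>p\<close> is at least
  the largest gap between set 1 and any set; it joins the items too large to move.\<close>

lemma frontier_skip:
  assumes "frontier K xs a (Suc p)"
    and "\<forall>l\<in>{1..K}. set_sum (items xs a) j \<le> set_sum (items xs a) l"
    and "set_sum (items xs a) 1 - set_sum (items xs a) j \<le> xs ! p"
  shows "frontier K xs a p"
  unfolding frontier_def
proof (intro conjI allI impI)
  fix q l
  assume ql: "p \<le> q \<and> q < length xs \<and> a q = 1 \<and> l \<in> {1..K}"
  show "set_sum (items xs a) 1 - set_sum (items xs a) l \<le> xs ! q"
  proof (cases "q = p")
    case True
    moreover have "set_sum (items xs a) j \<le> set_sum (items xs a) l"
      using assms(2) ql by blast
    ultimately show ?thesis
      using assms(3) by simp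
  next
    case False
    then have "Suc p \<le> q"
      using ql by simp
    then show ?thesis
      using assms(1) ql unfolding frontier_def by blast
  qed
qed (use assms(1) in \<open>simp_all add: frontier_def\<close>)

text \<open>The old minimum bounds every new sum from below and the sum of set 1 drops, so no gap
  exceeds the old maximal one. Sortedness handles set \<open>j\<close>: its items are at least
  \<open>xs ! p\<close>, so its new sum minus any of them is at most the old minimum.\<close>

lemma frontier_move:
  assumes "frontier K xs a (Suc p)" "sorted xs" "\<forall>x\<in>set xs. 0 < x" "j \<in> {1..K}"
    and min: "\<forall>l\<in>{1..K}. set_sum (items xs a) j \<le> set_sum (items xs a) l"
    and lt: "xs ! p < set_sum (items xs a) 1 - set_sum (items xs a) j"
  shows "frontier K xs (a(p := j)) p"
proof -
  let ?S = "set_sum (items xs a)" and ?S' = "set_sum (items xs (a(p := j)))"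
  have p: "p < length xs" "a p = 1"
    using assms(1) by (simp_all add: frontier_def)
  have pos: "0 < xs ! p"
    using assms(3) p nth_mem by blast
  have "j \<noteq> 1"
    using lt pos by auto
  then have S': "?S' k = (if k = 1 then ?S 1 - xs ! p else if k = j then ?S j + xs ! p else ?S k)" for k
    using set_sum_items_move[of p xs a 1 j k] p by auto
  \<comment> \<open>For \<open>l = 1\<close> this is \<open>lt\<close>, for \<open>l = j\<close> it
    is positivity of the moved item, otherwise it is \<open>min\<close>.\<close>
  have ge: "?S j \<le> ?S' l" if "l \<in> {1..K}" for l
    using bspec[OF min that] lt pos by (simp add: S')
  show ?thesis
    unfolding frontier_def
  proof (intro conjI allI impI)
    fix q l
    assume ql: "p \<le> q \<and> q < length xs \<and> (a(p := j)) q = 1 \<and> l \<in> {1..K}"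
    then have "q \<noteq> p" "a q = 1"
      using \<open>j \<noteq> 1\<close> by (simp_all split: if_splits)
    then have "Suc p \<le> q" "a q = 1"
      using ql by simp_all
    then have "?S 1 - ?S j \<le> xs ! q"
      using assms(1,4) ql unfolding frontier_def by blast
    then show "?S' 1 - ?S' l \<le> xs ! q"
      using ge[of l] ql pos by (simp add: S'[of 1])
  next
    fix q l
    assume ql: "q < length xs \<and> (a(p := j)) q \<noteq> 1 \<and> l \<in> {1..K}"
    show "?S' ((a(p := j)) q) - xs ! q \<le> ?S' l"
    proof (cases "(a(p := j)) q = j")
      case True
      \<comment> \<open>Everything below \<open>p\<close> is still in set 1, so all items of set
        \<open>j\<close> sit at \<open>p\<close> or above.\<close>
      have "a q = 1" if "q < p"
        using assms(1) that by (simp add: frontier_def)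
      then have "p \<le> q"
        using ql by (cases "q < p") simp_all
      then have "xs ! p \<le> xs ! q"
        using assms(2) ql by (simp add: sorted_nth_mono)
      then show ?thesis
        using True ge[of l] ql \<open>j \<noteq> 1\<close> by (simp add: S'[of j])
    next
      case False
      then have "q \<noteq> p" "a q \<noteq> 1" "a q \<noteq> j"
        using ql by (simp_all split: if_splits)
      then have "?S (a q) - xs ! q \<le> ?S j"
        using assms(1,4) ql unfolding frontier_def by blast
      then show ?thesis
        using \<open>q \<noteq> p\<close> \<open>a q \<noteq> 1\<close> \<open>a q \<noteq> j\<close> ge[of l] ql by (simp add: S'[of "a q"])
    qed
  qed (use assms(1,4) in \<open>simp_all add: frontier_def\<close>)
qed

text \<open>The last clause of \<open>frontier\<close>, taken at \<open>l = j\<close>, says that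
  each item of set \<open>i\<close> is at least the difference of the two sums.\<close>

lemma improving_frontier_other:
  assumes "frontier K xs a p" "\<forall>x\<in>set xs. 0 < x" "i \<noteq> 1" "j \<in> {1..K}"
    and "set_sum (items xs a) j \<le> set_sum (items xs a) i"
  shows "improving (items xs a) i j = {}"
proof -
  have "set_sum (items xs a) i - set_sum (items xs a) j \<le> x" if x: "x \<in># items xs a i" for x
  proof -
    obtain q where q: "q < length xs" "a q = i" "x = xs ! q"
      using x by (auto simp: mem_items)
    then have "a q \<noteq> 1"
      using assms(3) by simp
    then have "set_sum (items xs a) (a q) - xs ! q \<le> set_sum (items xs a) j"
      using assms(1,4) q(1) unfolding frontier_def by blast
    then show ?thesis
      using q by simp
  qed
  moreover have "\<forall>y\<in>#items xs a i. 0 < y"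
    using assms(2) by (auto simp: mem_items)
  ultimately have "x \<notin> improving (items xs a) i j" for x
    using improving_iff[OF assms(5), of x] by (meson not_less)
  then show ?thesis
    by blast
qed

lemma improving_frontier_0:
  assumes "frontier K xs a 0" "\<forall>x\<in>set xs. 0 < x" "j \<in> {1..K}"
    and "set_sum (items xs a) j \<le> set_sum (items xs a) 1"
  shows "improving (items xs a) 1 j = {}"
proof -
  have "set_sum (items xs a) 1 - set_sum (items xs a) j \<le> x" if "x \<in># items xs a 1" for x
    using that assms(1,3) by (auto simp: frontier_def mem_items)
  moreover have "\<forall>y\<in>#items xs a 1. 0 < y"
    using assms(2) by (auto simp: mem_items)
  ultimately have "x \<notin> improving (items xs a) 1 j" for x
    using improving_iff[OF assms(4), of x] by (meson not_less)
  then show ?thesis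
    by blast
qed

text \<open>Items of set 1 beyond \<open>p\<close> are too large by \<open>frontier\<close>, and
  those up to \<open>p\<close> are at most \<open>xs ! p\<close> by sortedness.\<close>

lemma Max_improving_frontier:
  assumes "frontier K xs a (Suc p)" "sorted xs" "\<forall>x\<in>set xs. 0 < x" "j \<in> {1..K}"
    and lt: "xs ! p < set_sum (items xs a) 1 - set_sum (items xs a) j"
  shows "improving (items xs a) 1 j \<noteq> {}" "Max (improving (items xs a) 1 j) = xs ! p"
proof -
  have p: "p < length xs" "a p = 1"
    using assms(1) by (simp_all add: frontier_def)
  have "0 < xs ! p"
    using assms(3) p nth_mem by blast
  then have le: "set_sum (items xs a) j \<le> set_sum (items xs a) 1"
    using lt by linarith
  have pos: "\<forall>y\<in>#items xs a 1. 0 < y"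
    using assms(3) by (auto simp: mem_items)
  note iff = improving_iff[OF le pos]
  have mem: "xs ! p \<in> improving (items xs a) 1 j"
    using p lt unfolding iff mem_items by blast
  then show "improving (items xs a) 1 j \<noteq> {}"
    by blast
  have "finite (improving (items xs a) 1 j)"
    by (rule finite_subset[of _ "set_mset (items xs a 1)"]) (auto simp: improving_def)
  moreover have "y \<le> xs ! p" if "y \<in> improving (items xs a) 1 j" for y
  proof -
    have "y \<in># items xs a 1" and y: "y < set_sum (items xs a) 1 - set_sum (items xs a) j"
      using that by (simp_all add: iff)
    then obtain q where q: "q < length xs" "a q = 1" "y = xs ! q"
      unfolding mem_items by blast
    have "set_sum (items xs a) 1 - set_sum (items xs a) j \<le> xs ! q" if "Suc p \<le> q"
      using assms(1,4) that q(1,2) unfolding frontier_def by blast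
    then have "\<not> Suc p \<le> q"
      using q(3) y by linarith
    then show ?thesis
      using sorted_nth_mono[OF assms(2), of q p] p q by simp
  qed
  ultimately show "Max (improving (items xs a) 1 j) = xs ! p"
    using mem by (intro Max_eqI)
qed

section \<open>Running programs\<close>

text \<open>The postcondition also receives the elapsed time, so correctness and cost are
  established in a single symbolic execution.\<close>

definition reach :: "program \<Rightarrow> (nat \<Rightarrow> config \<Rightarrow> bool) \<Rightarrow> config \<Rightarrow> bool" where
  "reach P Q c \<longleftrightarrow> (\<exists>t. Q t ((ram_step P ^^ t) c))"

lemma reach_refl: "Q 0 c \<Longrightarrow> reach P Q c"
  unfolding reach_def by (metis funpow_0)

lemma reach_step:
  assumes "pc c < length P" "reach P (\<lambda>t. Q (Suc t)) (exec_instr (P ! pc c) c)"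
  shows "reach P Q c"
proof -
  have "ram_step P c = exec_instr (P ! pc c) c"
    using assms(1) by (simp add: ram_step_def halted_def)
  then obtain t where "Q (Suc t) ((ram_step P ^^ t) (ram_step P c))"
    using assms(2) by (auto simp: reach_def)
  then have "Q (Suc t) ((ram_step P ^^ Suc t) c)"
    by (simp add: funpow_swap1)
  then show ?thesis
    unfolding reach_def by blast
qed

lemma reach_trans:
  assumes "reach P R c" "\<And>t c'. R t c' \<Longrightarrow> reach P (\<lambda>t'. Q (t + t')) c'"
  shows "reach P Q c"
proof -
  obtain t where "R t ((ram_step P ^^ t) c)"
    using assms(1) by (auto simp: reach_def)
  then obtain t' where "Q (t + t') ((ram_step P ^^ t') ((ram_step P ^^ t) c))"
    using assms(2) unfolding reach_def by blast
  then have "Q (t + t') ((ram_step P ^^ (t + t')) c)"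
    by (metis add.commute comp_apply funpow_add)
  then show ?thesis
    unfolding reach_def by blast
qed

lemma reach_mono:
  assumes "reach P R c" "\<And>t c'. R t c' \<Longrightarrow> Q t c'"
  shows "reach P Q c"
  using assms unfolding reach_def by blast

lemmas exec_defs =
  next_pc_def set_ireg_def set_rreg_def set_iarr_def set_rarr_def jump_if_def

section \<open>The program\<close>

text \<open>
  Integer registers: 1 and 9 hold the constants 1 and 0, 2 holds \<open>K\<close>, 3 the pointer of
  \<open>frontier\<close>, 4 the cardinality of \<open>I\<close>, 5 and 6 the selected indices \<open>i\<close> and \<open>j\<close>, and 7 the
  loop counter.  Real registers: 1 and 2 hold the sums \<open>S\<^sub>i\<close> and \<open>S\<^sub>j\<close>, 3 their difference.
\<close>

definition prog :: "nat \<Rightarrow> program" where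
  "prog K =
    [IConst 1 1,
     IConst 2 K,
     ICopy 3 0,
     ICopy 7 0,
     \<comment> \<open>4: put all items into set 1 and add them up\<close>
     IJumpEq 7 9 10,
     ISub 7 7 1,
     RLoad 4 0 7,
     RAdd 1 1 4,
     IStore 0 7 1,
     Jump 4,
     RStore 1 1 1,
     ICopy 7 2,
     \<comment> \<open>12: put all indices into \<open>I\<close>\<close>
     IJumpEq 7 9 16,
     IStore 1 7 1,
     ISub 7 7 1,
     Jump 12,
     ICopy 4 2,
     \<comment> \<open>17: main loop\<close>
     IJumpEq 4 1 50,
     RConst 1 (- 1),
     RLoad 2 1 1,
     ICopy 6 1,
     ICopy 7 2,
     \<comment> \<open>22: select \<open>i\<close> and \<open>j\<close>\<close>
     IJumpEq 7 9 34,
     RLoad 4 1 7,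
     RJumpLess 2 4 27,
     RCopy 2 4,
     ICopy 6 7,
     ILoad 8 1 7,
     IJumpEq 8 9 32,
     RJumpLess 4 1 32,
     RCopy 1 4,
     ICopy 5 7,
     ISub 7 7 1,
     Jump 22,
     IJumpEq 5 1 38,
     \<comment> \<open>35: discard \<open>i\<close>\<close>
     IStore 1 5 9,
     ISub 4 4 1,
     Jump 17,
     RSub 3 1 2,
     \<comment> \<open>39: lower the pointer until an item below the difference is found\<close>
     IJumpEq 3 9 35,
     ISub 3 3 1,
     RLoad 4 0 3,
     RJumpLess 4 3 44,
     Jump 39,
     \<comment> \<open>44: move that item\<close>
     IStore 0 3 6,
     RSub 1 1 4,
     RStore 1 1 1,
     RAdd 2 2 4,
     RStore 1 6 2,
     Jump 17]"

lemma length_prog [simp]: "length (prog K) = 50"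
  by (simp add: prog_def)

text \<open>Fetches instructions at concrete positions without unfolding \<open>prog\<close>
  elsewhere. The three forms match the normal forms \<open>0\<close>, \<open>Suc 0\<close> and
  numerals of the program counter.\<close>

lemmas prog_nth [simp] =
  prog_def [THEN arg_cong, of "\<lambda>P. P ! 0" for K]
  prog_def [THEN arg_cong, of "\<lambda>P. P ! Suc 0" for K]
  prog_def [THEN arg_cong, of "\<lambda>P. P ! numeral n" for n K]

declare exec_defs [simp]

text \<open>Executes the single instruction at a loop head, after which \<open>reach_next\<close>
  can be iterated.\<close>

lemma reach_head:
  assumes "pc c < 50" "reach (prog K) (\<lambda>t. Q (Suc t)) (exec_instr (prog K ! pc c) c)"
  shows "reach (prog K) Q c"
  by (rule reach_step) (simp_all only: length_prog assms)

text \<open>Stops at the loop heads, so that it can be iterated.\<close>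

lemma reach_next:
  assumes "pc c < 50" "pc c \<notin> {4, 12, 17, 22, 39}"
    "reach (prog K) (\<lambda>t. Q (Suc t)) (exec_instr (prog K ! pc c) c)"
  shows "reach (prog K) Q c"
  using assms(1,3) by (rule reach_head)

section \<open>Initialization loops\<close>

text \<open>The counter is decremented before the access, so cells \<open>0\<close> to
  \<open>k - 1\<close> are visited; a pass takes six instructions and the exit test one.\<close>

lemma item_loop:
  assumes "pc c = 4" "ireg c 1 = 1" "ireg c 9 = 0" "ireg c 7 = k"
  shows "reach (prog K)
    (\<lambda>t c'. t = 6 * k + 1 \<and> pc c' = 10 \<and> (\<forall>r. r \<noteq> 7 \<longrightarrow> ireg c' r = ireg c r) \<and>
       rreg c' 1 = rreg c 1 + (\<Sum>q<k. rarr c 0 q) \<and> rarr c' = rarr c \<and>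
       iarr c' = (iarr c)(0 := \<lambda>q. if q < k then 1 else iarr c 0 q)) c"
  using assms
proof (induction k arbitrary: c)
  case 0
  note [simp] = 0
  show ?case
    apply (rule reach_head, simp, simp)
    apply (rule reach_refl)
    apply (simp add: fun_eq_iff)
    done
next
  case (Suc k)
  note [simp] = Suc.prems
  show ?case
    apply (rule reach_head, simp, simp)
    apply (rule reach_next, simp, simp, simp)+
    apply (rule reach_mono, rule Suc.IH)
    apply (auto simp: fun_eq_iff less_Suc_eq)
    done
qed

text \<open>Here the access precedes the decrement, so cells \<open>1\<close> to \<open>k\<close>
  are written, matching the numbering of the sets.\<close>

lemma index_loop:
  assumes "pc c = 12" "ireg c 1 = 1" "ireg c 9 = 0" "ireg c 7 = k"
  shows "reach (prog K)
    (\<lambda>t c'. t = 4 * k + 1 \<and> pc c' = 16 \<and> (\<forall>r. r \<noteq> 7 \<longrightarrow> ireg c' r = ireg c r) \<and>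
       rarr c' = rarr c \<and>
       iarr c' = (iarr c)(1 := \<lambda>l. if 0 < l \<and> l \<le> k then 1 else iarr c 1 l)) c"
  using assms
proof (induction k arbitrary: c)
  case 0
  note [simp] = 0
  show ?case
    apply (rule reach_head, simp, simp)
    apply (rule reach_refl)
    apply (simp add: fun_eq_iff)
    done
next
  case (Suc k)
  note [simp] = Suc.prems
  show ?case
    apply (rule reach_head, simp, simp)
    apply (rule reach_next, simp, simp, simp)+
    apply (rule reach_mono, rule Suc.IH)
    apply (auto simp: fun_eq_iff le_Suc_eq)
    done
qed

section \<open>Selecting the largest and the smallest sum\<close>

text \<open>Loop invariant after scanning the indices above \<open>k\<close>. The minimum starts
  with set 1 as candidate; the maximum starts with the sentinel \<open>- 1\<close>, which stands for
  no index of \<open>I\<close> seen so far.\<close>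

definition selected :: "nat \<Rightarrow> nat set \<Rightarrow> nat \<Rightarrow> config \<Rightarrow> bool" where
  "selected K I k c \<longleftrightarrow>
     ireg c 6 \<in> {1..K} \<and> rreg c 2 = rarr c 1 (ireg c 6) \<and>
     (\<forall>l\<in>{1..K}. k < l \<longrightarrow> rreg c 2 \<le> rarr c 1 l) \<and>
     ((rreg c 1 = - 1 \<and> (\<forall>l\<in>I. l \<le> k)) \<or>
      (ireg c 5 \<in> I \<and> rreg c 1 = rarr c 1 (ireg c 5) \<and> (\<forall>l\<in>I. k < l \<longrightarrow> rarr c 1 l \<le> rreg c 1)))"

lemma select_step:
  assumes "pc c = 22" "ireg c 1 = 1" "ireg c 9 = 0" "ireg c 7 = Suc k" "Suc k \<le> K"
    and "iarr c 1 (Suc k) = (if Suc k \<in> I then 1 else 0)"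
    and nonneg: "0 \<le> rarr c 1 (Suc k)"
    and sel: "selected K I (Suc k) c"
  shows "reach (prog K)
    (\<lambda>t c'. t \<le> 12 \<and> pc c' = 22 \<and> (\<forall>r. r \<notin> {5, 6, 7, 8} \<longrightarrow> ireg c' r = ireg c r) \<and>
       ireg c' 7 = k \<and> iarr c' = iarr c \<and> rarr c' = rarr c \<and> selected K I k c') c"
proof -
  note [simp] = assms(1-4,6)
  define v where "v = rarr c 1 (Suc k)"
  have [simp]: "rarr c 1 (Suc k) = v"
    by (simp add: v_def)
  \<comment> \<open>Symbolic execution of one pass, with the eight outcomes of the tests merged into
    conditionals; the longest path has 12 instructions. Preservation of the invariant is then a
    separate, purely logical claim.\<close>
  have run: "reach (prog K)
    (\<lambda>t c'. t \<le> 12 \<and> pc c' = 22 \<and> (\<forall>r. r \<notin> {5, 6, 7, 8} \<longrightarrow> ireg c' r = ireg c r) \<and>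
       ireg c' 7 = k \<and> iarr c' = iarr c \<and> rarr c' = rarr c \<and>
       rreg c' 2 = (if rreg c 2 < v then rreg c 2 else v) \<and>
       ireg c' 6 = (if rreg c 2 < v then ireg c 6 else Suc k) \<and>
       rreg c' 1 = (if Suc k \<in> I \<and> \<not> v < rreg c 1 then v else rreg c 1) \<and>
       ireg c' 5 = (if Suc k \<in> I \<and> \<not> v < rreg c 1 then Suc k else ireg c 5)) c"
    apply (cases "rreg c 2 < v"; cases "Suc k \<in> I"; cases "v < rreg c 1")
    apply (rule reach_head, simp, simp, (rule reach_next, simp, simp, simp)+, rule reach_refl, simp)+
    done
  have sel': "selected K I k c'"
    if c': "rarr c' = rarr c"
      "rreg c' 2 = (if rreg c 2 < v then rreg c 2 else v)"
      "ireg c' 6 = (if rreg c 2 < v then ireg c 6 else Suc k)"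
      "rreg c' 1 = (if Suc k \<in> I \<and> \<not> v < rreg c 1 then v else rreg c 1)"
      "ireg c' 5 = (if Suc k \<in> I \<and> \<not> v < rreg c 1 then Suc k else ireg c 5)" for c'
  proof -
    have "ireg c' 6 \<in> {1..K}" "rreg c' 2 = rarr c' 1 (ireg c' 6)"
      using sel \<open>Suc k \<le> K\<close> by (auto simp: c' selected_def)
    moreover have "rreg c' 2 \<le> rarr c' 1 l" if "l \<in> {1..K}" "k < l" for l
    proof (cases "l = Suc k")
      case False
      then have "rreg c 2 \<le> rarr c 1 l"
        using sel that by (auto simp: selected_def)
      then show ?thesis by (simp add: c')
    qed (simp add: c')
    moreover have "(rreg c' 1 = - 1 \<and> (\<forall>l\<in>I. l \<le> k)) \<or>
      (ireg c' 5 \<in> I \<and> rreg c' 1 = rarr c' 1 (ireg c' 5) \<and>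
       (\<forall>l\<in>I. k < l \<longrightarrow> rarr c' 1 l \<le> rreg c' 1))"
    proof (cases "rreg c 1 = - 1 \<and> (\<forall>l\<in>I. l \<le> Suc k)")
      case True
      then have le: "l \<le> Suc k" if "l \<in> I" for l
        using that by blast
      \<comment> \<open>Sums are nonnegative, so the sentinel is replaced by the first index of
        \<open>I\<close> encountered.\<close>
      have v: "\<not> v < rreg c 1"
        using nonneg True by simp
      show ?thesis
      proof (cases "Suc k \<in> I")
        case True
        have "rarr c' 1 l \<le> v" if "l \<in> I" "k < l" for l
        proof -
          have "l = Suc k"
            using le[OF that(1)] that(2) by linarith
          then show ?thesis
            by (simp add: c')
        qed
        then show ?thesis
          using v True by (simp add: c')
      next
        case False
        then have "l \<le> k" if "l \<in> I" for l
          using le[OF that] that by (metis le_SucE)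
        then show ?thesis
          using False \<open>rreg c 1 = - 1 \<and> _\<close> by (simp add: c'(4))
      qed
    next
      case False
      then have I: "ireg c 5 \<in> I" "rreg c 1 = rarr c 1 (ireg c 5)"
        "\<And>l. l \<in> I \<Longrightarrow> Suc k < l \<Longrightarrow> rarr c 1 l \<le> rreg c 1"
        using sel by (auto simp: selected_def)
      have "rarr c' 1 l \<le> rreg c' 1" if "l \<in> I" "k < l" for l
        using I(3)[of l] that by (cases "l = Suc k") (auto simp: c')
      then show ?thesis
        using I(1,2) by (simp add: c')
    qed
    ultimately show ?thesis
      by (simp add: selected_def)
  qed
  show ?thesis
    by (rule reach_mono[OF run]) (simp add: sel')
qed

lemma select_loop:
  assumes "pc c = 22" "ireg c 1 = 1" "ireg c 9 = 0" "ireg c 7 = k" "k \<le> K"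
    and "\<forall>l\<in>{1..K}. iarr c 1 l = (if l \<in> I then 1 else 0)" "\<forall>l\<in>{1..K}. 0 \<le> rarr c 1 l"
    and "selected K I k c"
  shows "reach (prog K)
    (\<lambda>t c'. t \<le> 12 * k + 1 \<and> pc c' = 34 \<and> (\<forall>r. r \<notin> {5, 6, 7, 8} \<longrightarrow> ireg c' r = ireg c r) \<and>
       iarr c' = iarr c \<and> rarr c' = rarr c \<and> selected K I 0 c') c"
  using assms
proof (induction k arbitrary: c)
  case 0
  note [simp] = 0(1-4)
  show ?case
    apply (rule reach_head, simp, simp)
    apply (rule reach_refl)
    using 0(8)
    apply (auto simp: selected_def)
    done
next
  case (Suc k)
  show ?case
  proof (rule reach_trans[OF select_step[of c k K I]])
    fix t :: nat and c'
    assume c': "t \<le> 12 \<and> pc c' = 22 \<and> (\<forall>r. r \<notin> {5, 6, 7, 8} \<longrightarrow> ireg c' r = ireg c r) \<and>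
       ireg c' 7 = k \<and> iarr c' = iarr c \<and> rarr c' = rarr c \<and> selected K I k c'"
    show "reach (prog K) (\<lambda>t' c''. t + t' \<le> 12 * Suc k + 1 \<and> pc c'' = 34 \<and>
        (\<forall>r. r \<notin> {5, 6, 7, 8} \<longrightarrow> ireg c'' r = ireg c r) \<and>
        iarr c'' = iarr c \<and> rarr c'' = rarr c \<and> selected K I 0 c'') c'"
      by (rule reach_mono[OF Suc.IH]) (use Suc.prems c' in auto)
  qed (use Suc.prems in auto)
qed

section \<open>One round of the main loop\<close>

text \<open>The invariant of the main loop: \<open>represents\<close> strengthened by the register
  contents and by the \<open>frontier\<close> property of the pointer.\<close>

definition layout :: "nat \<Rightarrow> real list \<Rightarrow> nat set \<Rightarrow> config \<Rightarrow> bool" where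
  "layout K xs I c \<longleftrightarrow>
     ireg c 1 = 1 \<and> ireg c 2 = K \<and> ireg c 9 = 0 \<and> ireg c 4 = card I \<and> I \<subseteq> {1..K} \<and> I \<noteq> {} \<and>
     (\<forall>q<length xs. rarr c 0 q = xs ! q) \<and>
     (\<forall>k\<in>{1..K}. iarr c 1 k = (if k \<in> I then 1 else 0)) \<and>
     (\<forall>k\<in>{1..K}. rarr c 1 k = set_sum (items xs (iarr c 0)) k) \<and>
     frontier K xs (iarr c 0) (ireg c 3)"

lemma layout_represents:
  assumes "layout K xs I c"
  shows "represents K xs c (items xs (iarr c 0), I)"
proof -
  have "\<forall>k\<in>{1..K}. items xs (iarr c 0) k =
      image_mset (\<lambda>p. xs ! p) (mset_set {p. p < length xs \<and> iarr c 0 p = k})"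
    by (simp add: items_def)
  then show ?thesis
    using assms by (simp add: layout_def represents_def frontier_def)
qed

lemma layout_finite: "layout K xs I c \<Longrightarrow> finite I"
  unfolding layout_def by (elim conjE) (rule finite_subset[OF _ finite_atLeastAtMost])

lemma discard_block:
  assumes "pc c = 35" "layout K xs I c" "ireg c 5 \<in> I" "card I \<noteq> 1"
  shows "reach (prog K)
    (\<lambda>t c'. t = 3 \<and> pc c' = 17 \<and> layout K xs (I - {ireg c 5}) c' \<and>
       iarr c' 0 = iarr c 0 \<and> ireg c' 3 = ireg c 3) c"
proof -
  have [simp]: "pc c = 35" "ireg c 9 = 0" "ireg c 1 = 1"
    using assms by (auto simp: layout_def)
  have "finite I"
    using assms(2) by (rule layout_finite)
  then have "I - {ireg c 5} \<noteq> {}"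
    using assms(3,4) by (metis card_1_singleton_iff insert_Diff One_nat_def)
  then show ?thesis
    apply -
    apply (rule reach_next, simp, simp, simp)+
    apply (rule reach_refl)
    using assms(2,3) \<open>finite I\<close>
    apply (auto simp: layout_def)
    done
qed

text \<open>Amortized cost of one algorithm step with potential pointer plus \<open>card I\<close>:
  the potential drops strictly, and the time is at most \<open>b\<close> plus 5 per unit of drop.
  The bound is kept additive to avoid truncated subtraction.\<close>

definition advanced ::
  "nat \<Rightarrow> real list \<Rightarrow> nat set \<Rightarrow> (nat \<Rightarrow> nat) \<Rightarrow> nat \<Rightarrow> nat \<Rightarrow> nat \<Rightarrow> config \<Rightarrow> bool" where
  "advanced K xs I a p b t c \<longleftrightarrow>
     (\<exists>I'. alg_step K (items xs a, I) (items xs (iarr c 0), I') \<and> pc c = 17 \<and> layout K xs I' c \<and>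
        ireg c 3 + card I' < p + card I \<and>
        t + 5 * (ireg c 3 + card I') \<le> b + 5 * (p + card I))"

lemma advanced_discard:
  assumes "pc c = 35" "layout K xs I c" "ireg c 5 \<in> I" "card I \<noteq> 1"
    and "alg_step K (items xs (iarr c 0), I) (items xs (iarr c 0), I - {ireg c 5})"
  shows "reach (prog K) (advanced K xs I (iarr c 0) (ireg c 3) 3) c"
proof (rule reach_mono[OF discard_block[OF assms(1-4)]])
  fix t :: nat and c'
  assume c': "t = 3 \<and> pc c' = 17 \<and> layout K xs (I - {ireg c 5}) c' \<and>
       iarr c' 0 = iarr c 0 \<and> ireg c' 3 = ireg c 3"
  have "finite I"
    using assms(2) by (rule layout_finite)
  then have "card (I - {ireg c 5}) < card I"
    using assms(3) by (rule card_Diff1_less)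
  then show "advanced K xs I (iarr c 0) (ireg c 3) 3 t c'"
    unfolding advanced_def using assms(5) c' by (intro exI[of _ "I - {ireg c 5}"]) simp
qed

text \<open>Skipping an item costs five instructions, paid for by the pointer decrement, and changes
  neither sums nor state. The scan ends with a move, or with discarding set 1 when the pointer is
  0.\<close>

lemma scan_loop:
  assumes "sorted xs" "\<forall>x\<in>set xs. 0 < x" "card I \<noteq> 1" "1 \<in> I"
    and "pc c = 39" "layout K xs I c" "ireg c 5 = 1" "ireg c 6 = j" "j \<in> {1..K}"
    and "rreg c 1 = set_sum (items xs (iarr c 0)) 1"
    and "rreg c 2 = set_sum (items xs (iarr c 0)) j"
    and "rreg c 3 = rreg c 1 - rreg c 2"
    and "\<forall>l\<in>I. set_sum (items xs (iarr c 0)) l \<le> set_sum (items xs (iarr c 0)) 1"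
    and "\<forall>l\<in>{1..K}. set_sum (items xs (iarr c 0)) j \<le> set_sum (items xs (iarr c 0)) l"
    and "ireg c 3 = p"
  shows "reach (prog K) (advanced K xs I (iarr c 0) p 6) c"
  using assms(5-)
proof (induction p arbitrary: c)
  case 0
  have [simp]: "ireg c 9 = 0" and I: "I \<subseteq> {1..K}" and frontier: "frontier K xs (iarr c 0) 0"
    using 0(2,11) by (simp_all add: layout_def)
  have "set_sum (items xs (iarr c 0)) j \<le> set_sum (items xs (iarr c 0)) 1"
    using 0(10) I assms(4) by blast
  then have "improving (items xs (iarr c 0)) 1 j = {}"
    by (rule improving_frontier_0[OF frontier assms(2) 0(5)])
  then have step: "alg_step K (items xs (iarr c 0), I) (items xs (iarr c 0), I - {1})"
    using 0(5,9,10) assms(3,4) by (intro alg_step.discard[where j = j])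
      (simp_all add: stopped_def is_arg_max_def is_arg_min_def not_less)
  note [simp] = 0(1,3,11)
  show ?case
    apply (rule reach_head, simp, simp)
    apply (rule reach_mono, rule advanced_discard[of _ K xs I])
    using 0(2) assms(3,4) step
         apply (simp_all add: layout_def advanced_def)
    apply (elim exE, rule exI, force)
    done
next
  case (Suc p)
  have regs: "ireg c 9 = 0" "ireg c 1 = 1" and I: "I \<subseteq> {1..K}"
    and frontier: "frontier K xs (iarr c 0) (Suc p)"
    using Suc.prems(2,11) by (simp_all add: layout_def)
  have p: "p < length xs" "iarr c 0 p = 1"
    using frontier by (simp_all add: frontier_def)
  have x: "rarr c 0 p = xs ! p"
    using Suc.prems(2) p by (simp add: layout_def)
  note [simp] = Suc.prems(1,3,4,11) regs x
  show ?case
  proof (cases "xs ! p < rreg c 3")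
    case lt [simp]: True
    then have lt': "xs ! p < set_sum (items xs (iarr c 0)) 1 - set_sum (items xs (iarr c 0)) j"
      using Suc.prems(6-8) by simp
    have "0 < xs ! p"
      using assms(2) p nth_mem by blast
    then have j: "j \<noteq> 1"
      using lt' by auto
    note Max = Max_improving_frontier[OF frontier assms(1,2) Suc.prems(5) lt']
    have "alg_step K (items xs (iarr c 0), I)
        ((items xs (iarr c 0))(1 := items xs (iarr c 0) 1 - {#xs ! p#},
           j := add_mset (xs ! p) (items xs (iarr c 0) j)), I)"
      using Suc.prems(5,9,10) assms(3,4) Max by (intro alg_step.move)
        (simp_all add: stopped_def is_arg_max_def is_arg_min_def not_less)
    then have step: "alg_step K (items xs (iarr c 0), I) (items xs ((iarr c 0)(p := j)), I)"
      using items_move[of p xs "iarr c 0" 1 j] p j by simp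
    have sums: "set_sum (items xs ((iarr c 0)(p := j))) k =
        (if k = 1 then set_sum (items xs (iarr c 0)) 1 - xs ! p
         else if k = j then set_sum (items xs (iarr c 0)) j + xs ! p
         else set_sum (items xs (iarr c 0)) k)" for k
      using set_sum_items_move[of p xs "iarr c 0" 1 j k] p j by simp
    have frontier': "frontier K xs ((iarr c 0)(p := j)) p"
      using frontier_move[OF frontier assms(1,2) Suc.prems(5,10) lt'] .
    show ?thesis
      apply (rule reach_head, simp, simp)
      apply (rule reach_next, simp, simp, simp)+
      apply (rule reach_refl)
      unfolding advanced_def
      apply (rule exI[of _ I])
      using Suc.prems(2,6,7) step frontier' j
      apply (simp add: layout_def sums)
      done
  next
    case False
    then have ge: "set_sum (items xs (iarr c 0)) 1 - set_sum (items xs (iarr c 0)) j \<le> xs ! p"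
      using Suc.prems(6-8) by simp
    have frontier': "frontier K xs (iarr c 0) p"
      using frontier_skip[OF frontier Suc.prems(10) ge] .
    note [simp] = False
    show ?thesis
      apply (rule reach_head, simp, simp)
      apply (rule reach_next, simp, simp, simp)+
      apply (rule reach_mono, rule Suc.IH)
      using Suc.prems frontier'
                 apply (simp_all add: layout_def advanced_def)
      apply (elim exE, rule exI, force)
      done
  qed
qed

text \<open>Setup and selection take at most \<open>12 * K + 6\<close> instructions. The remaining 8
  cover at most two instructions of dispatch and the allowance 6 of \<open>scan_loop\<close>; a set
  other than 1 is discarded within them.\<close>

lemma main_block:
  assumes "sorted xs" "\<forall>x\<in>set xs. 0 < x" "pc c = 17" "layout K xs I c" "card I \<noteq> 1"
  shows "reach (prog K) (advanced K xs I (iarr c 0) (ireg c 3) (12 * K + 14)) c"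
proof -
  let ?S = "set_sum (items xs (iarr c 0))"
  have regs: "ireg c 1 = 1" "ireg c 2 = K" "ireg c 4 = card I"
    and I: "I \<subseteq> {1..K}" "I \<noteq> {}"
    and mem: "\<forall>k\<in>{1..K}. iarr c 1 k = (if k \<in> I then 1 else 0)"
    and sums: "\<forall>k\<in>{1..K}. rarr c 1 k = ?S k"
    and frontier: "frontier K xs (iarr c 0) (ireg c 3)"
    using assms(4) by (simp_all add: layout_def)
  have K: "1 \<le> K"
    using I by auto
  have nonneg: "\<forall>k\<in>{1..K}. 0 \<le> rarr c 1 k"
    using sums set_sum_items_nonneg[OF assms(2)] by simp
  note [simp] = assms(3,5) regs
  have select: "reach (prog K)
    (\<lambda>t c'. t \<le> 12 * K + 6 \<and> pc c' = 34 \<and> (\<forall>r. r \<notin> {5, 6, 7, 8} \<longrightarrow> ireg c' r = ireg c r) \<and>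
       iarr c' = iarr c \<and> rarr c' = rarr c \<and> selected K I 0 c') c"
    apply (rule reach_head, simp, simp)
    apply (rule reach_next, simp, simp, simp)+
    apply (rule reach_mono, rule select_loop[where I = I and k = K])
    using assms(4) K I mem nonneg
            apply (auto simp: layout_def selected_def)
    done
  show ?thesis
  proof (rule reach_trans[OF select])
    fix t :: nat and c'
    assume "t \<le> 12 * K + 6 \<and> pc c' = 34 \<and> (\<forall>r. r \<notin> {5, 6, 7, 8} \<longrightarrow> ireg c' r = ireg c r) \<and>
       iarr c' = iarr c \<and> rarr c' = rarr c \<and> selected K I 0 c'"
    then have t: "t \<le> 12 * K + 6" and [simp]: "pc c' = 34" "iarr c' = iarr c" "rarr c' = rarr c"
      and keep: "\<And>r. r \<notin> {5, 6, 7, 8} \<Longrightarrow> ireg c' r = ireg c r" and sel: "selected K I 0 c'"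
      by simp_all
    have [simp]: "ireg c' 1 = 1" "ireg c' 3 = ireg c 3"
      by (simp_all add: keep)
    have lay: "layout K xs I c'"
      using assms(4) by (simp add: layout_def keep)
    define i j where "i = ireg c' 5" and "j = ireg c' 6"
    have ij [simp]: "ireg c' 5 = i" "ireg c' 6 = j"
      by (simp_all add: i_def j_def)
    have j: "j \<in> {1..K}" "rreg c' 2 = ?S j" "\<forall>l\<in>{1..K}. ?S j \<le> ?S l"
      using sel sums by (auto simp: selected_def)
    \<comment> \<open>As \<open>I\<close> is a nonempty set of positive indices, this rules out that
      the sentinel survived.\<close>
    have "\<not> (\<forall>l\<in>I. l \<le> 0)"
      using I by fastforce
    then have i: "i \<in> I" "rreg c' 1 = rarr c 1 i" "\<forall>l\<in>I. 0 < l \<longrightarrow> rarr c 1 l \<le> rreg c' 1"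
      using sel by (auto simp: selected_def)
    have "i \<in> {1..K}"
      using i(1) I by blast
    then have Si: "rreg c' 1 = ?S i"
      using i(2) sums by simp
    have max: "\<forall>l\<in>I. ?S l \<le> ?S i"
    proof
      fix l
      assume l: "l \<in> I"
      then have "l \<in> {1..K}"
        using I by blast
      then have "rarr c 1 l = ?S l" "0 < l"
        using sums by simp_all
      then show "?S l \<le> ?S i"
        using i(3) l Si by fastforce
    qed
    have "reach (prog K) (\<lambda>t'. advanced K xs I (iarr c 0) (ireg c 3) 8 t') c'"
    proof (cases "i = 1")
      case [simp]: True
      show ?thesis
        apply (rule reach_next, simp, simp, simp)
        apply (rule reach_next, simp, simp, simp)
        apply (rule reach_mono, rule scan_loop[of xs I _ K j "ireg c 3", OF assms(1,2,5)])
        using i(1) j Si max lay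
                     apply (simp_all add: layout_def advanced_def)
        done
    next
      case [simp]: False
      have "improving (items xs (iarr c 0)) i j = {}"
        using improving_frontier_other[OF frontier assms(2) False j(1)] j(3) \<open>i \<in> {1..K}\<close> by blast
      then have step: "alg_step K (items xs (iarr c 0), I) (items xs (iarr c 0), I - {i})"
        using j max i(1) by (intro alg_step.discard[where j = j])
          (simp_all add: stopped_def is_arg_max_def is_arg_min_def not_less)
      show ?thesis
        apply (rule reach_next, simp, simp, simp)
        apply (rule reach_mono, rule advanced_discard[of _ K xs I])
        using i(1) step lay
             apply (simp_all add: layout_def advanced_def)
        apply (elim exE, rule exI, force)
        done
    qed
    then show "reach (prog K) (\<lambda>t'. advanced K xs I (iarr c 0) (ireg c 3) (12 * K + 14) (t + t')) c'"
      by (rule reach_mono) (use t in \<open>force simp: advanced_def\<close>)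
  qed
qed

section \<open>Complete runs and their total time\<close>

text \<open>Generalizes \<open>implements_within\<close> to an arbitrary starting state and
  configuration, as the induction over rounds requires.\<close>

definition runs :: "program \<Rightarrow> nat \<Rightarrow> real list \<Rightarrow> state \<Rightarrow> config \<Rightarrow> nat \<Rightarrow> bool" where
  "runs P K xs s c t \<longleftrightarrow>
     (\<exists>(m::nat) \<sigma> \<tau>.
        \<sigma> 0 = s \<and> (\<forall>r<m. alg_step K (\<sigma> r) (\<sigma> (Suc r))) \<and> stopped (\<sigma> m) \<and>
        (\<forall>r<m. \<tau> r < \<tau> (Suc r)) \<and>
        (\<forall>r\<le>m. represents K xs ((ram_step P ^^ \<tau> r) c) (\<sigma> r)) \<and>
        halted P ((ram_step P ^^ \<tau> m) c) \<and> \<tau> m \<le> t)"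

lemma runs_init_iff_implements:
  "runs P K xs (init_state K xs) (init_config xs) t \<longleftrightarrow> implements_within P K xs t"
  by (simp add: runs_def implements_within_def config_at_def)

lemma runs_mono: "runs P K xs s c t \<Longrightarrow> t \<le> u \<Longrightarrow> runs P K xs s c u"
  unfolding runs_def by (elim exE conjE, intro exI conjI) (assumption+, simp)

lemma runs_stopped:
  assumes "stopped s" "represents K xs ((ram_step P ^^ t) c) s" "halted P ((ram_step P ^^ t) c)"
  shows "runs P K xs s c t"
  unfolding runs_def
  by (rule exI[of _ 0], rule exI[of _ "\<lambda>_. s"], rule exI[of _ "\<lambda>_. t"]) (use assms in simp)

lemma runs_delay:
  assumes "runs P K xs s ((ram_step P ^^ t) c) u"
  shows "runs P K xs s c (t + u)"
proof -
  obtain m \<sigma> \<tau> where "\<sigma> 0 = s" "\<forall>r<m. alg_step K (\<sigma> r) (\<sigma> (Suc r))" "stopped (\<sigma> m)"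
    "\<forall>r<m. \<tau> r < \<tau> (Suc r)"
    "\<forall>r\<le>m. represents K xs ((ram_step P ^^ \<tau> r) ((ram_step P ^^ t) c)) (\<sigma> r)"
    "halted P ((ram_step P ^^ \<tau> m) ((ram_step P ^^ t) c))" "\<tau> m \<le> u"
    using assms unfolding runs_def by blast
  then show ?thesis
    unfolding runs_def
    by (intro exI[of _ m] exI[of _ \<sigma>] exI[of _ "\<lambda>r. \<tau> r + t"]) (simp add: funpow_add)
qed

lemma runs_step:
  assumes "alg_step K s s'" "represents K xs c s" "0 < t" "runs P K xs s' ((ram_step P ^^ t) c) u"
  shows "runs P K xs s c (t + u)"
proof -
  obtain m \<sigma> \<tau> where run: "\<sigma> 0 = s'" "\<forall>r<m. alg_step K (\<sigma> r) (\<sigma> (Suc r))" "stopped (\<sigma> m)"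
    "\<forall>r<m. \<tau> r < \<tau> (Suc r)"
    "\<forall>r\<le>m. represents K xs ((ram_step P ^^ \<tau> r) ((ram_step P ^^ t) c)) (\<sigma> r)"
    "halted P ((ram_step P ^^ \<tau> m) ((ram_step P ^^ t) c))" "\<tau> m \<le> u"
    using assms(4) unfolding runs_def by blast
  \<comment> \<open>Prepends \<open>s\<close> at time 0 and shifts the later times by
    \<open>t\<close>; \<open>0 < t\<close> keeps the times strictly increasing.\<close>
  define \<sigma>' \<tau>' where "\<sigma>' = case_nat s \<sigma>" and "\<tau>' = case_nat 0 (\<lambda>r. \<tau> r + t)"
  have "alg_step K (\<sigma>' r) (\<sigma>' (Suc r))" "\<tau>' r < \<tau>' (Suc r)" if "r < Suc m" for r
    using that run assms(1,3) by (cases r; simp add: \<sigma>'_def \<tau>'_def)+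
  moreover have "represents K xs ((ram_step P ^^ \<tau>' r) c) (\<sigma>' r)" if "r \<le> Suc m" for r
    using that run assms(2) by (cases r) (simp_all add: \<sigma>'_def \<tau>'_def funpow_add)
  moreover have "\<sigma>' 0 = s" "stopped (\<sigma>' (Suc m))" "\<tau>' (Suc m) \<le> t + u"
    "halted P ((ram_step P ^^ \<tau>' (Suc m)) c)"
    using run by (simp_all add: \<sigma>'_def \<tau>'_def funpow_add)
  ultimately show ?thesis
    unfolding runs_def by blast
qed

text \<open>Induction on the potential. Each round lowers it by at least one, so a round costs at
  most \<open>12 * K + 19\<close> per unit of drop; the final 1 is the halting jump.\<close>

lemma runs_main_loop:
  assumes "sorted xs" "\<forall>x\<in>set xs. 0 < x" "pc c = 17" "layout K xs I c"
  shows "runs (prog K) K xs (items xs (iarr c 0), I) c ((12 * K + 19) * (ireg c 3 + card I) + 1)"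
  using assms(3,4)
proof (induction "ireg c 3 + card I" arbitrary: c I rule: less_induct)
  case less
  note rep = layout_represents[OF less.prems(2)]
  show ?case
  proof (cases "card I = 1")
    case True
    then have "ram_step (prog K) c = c\<lparr>pc := 50\<rparr>"
      using less.prems by (simp add: ram_step_def halted_def layout_def)
    then have "runs (prog K) K xs (items xs (iarr c 0), I) c 1"
      using True rep by (intro runs_stopped)
        (simp_all add: stopped_def halted_def represents_def One_nat_def)
    then show ?thesis
      by (rule runs_mono) simp
  next
    case False
    from main_block[OF assms(1,2) less.prems False] obtain t
      where "advanced K xs I (iarr c 0) (ireg c 3) (12 * K + 14) t ((ram_step (prog K) ^^ t) c)"
      unfolding reach_def by blast
    then obtain I' c' where c': "c' = (ram_step (prog K) ^^ t) c"
      and step: "alg_step K (items xs (iarr c 0), I) (items xs (iarr c' 0), I')"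
      and next_conf: "pc c' = 17" "layout K xs I' c'"
      and lt: "ireg c' 3 + card I' < ireg c 3 + card I"
      and t: "t + 5 * (ireg c' 3 + card I') \<le> 12 * K + 14 + 5 * (ireg c 3 + card I)"
      unfolding advanced_def by blast
    \<comment> \<open>With no instruction executed, the pointer and register 4, hence the potential,
      would be unchanged.\<close>
    have "t \<noteq> 0"
    proof
      assume "t = 0"
      then have "c' = c"
        by (simp add: c')
      then have "card I' = card I"
        using next_conf(2) less.prems(2) by (simp add: layout_def)
      then show False
        using lt \<open>c' = c\<close> by simp
    qed
    then have "runs (prog K) K xs (items xs (iarr c 0), I) c
        (t + ((12 * K + 19) * (ireg c' 3 + card I') + 1))"
      using less.hyps[OF lt next_conf] by (intro runs_step[OF step rep]) (simp_all add: c')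
    moreover have "t + (12 * K + 19) * (ireg c' 3 + card I') \<le> (12 * K + 19) * (ireg c 3 + card I)"
    proof -
      have "t + (12 * K + 19) * (ireg c' 3 + card I')
          = t + 5 * (ireg c' 3 + card I') + (12 * K + 14) * (ireg c' 3 + card I')"
        by (simp add: algebra_simps)
      also have "\<dots> \<le> 12 * K + 14 + 5 * (ireg c 3 + card I) + (12 * K + 14) * (ireg c' 3 + card I')"
        using t by simp
      also have "\<dots> = (12 * K + 14) * Suc (ireg c' 3 + card I') + 5 * (ireg c 3 + card I)"
        by (simp add: algebra_simps)
      also have "\<dots> \<le> (12 * K + 14) * (ireg c 3 + card I) + 5 * (ireg c 3 + card I)"
        using lt by (intro add_right_mono mult_le_mono2) simp
      finally show ?thesis
        by (simp add: algebra_simps)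
    qed
    ultimately show ?thesis
      by (elim runs_mono) simp
  qed
qed

lemma init_block:
  assumes "1 \<le> K"
  shows "reach (prog K)
    (\<lambda>t c. t = 6 * length xs + 4 * K + 9 \<and> pc c = 17 \<and> layout K xs {1..K} c \<and>
       ireg c 3 = length xs \<and> (\<forall>q<length xs. iarr c 0 q = 1)) (init_config xs)"
proof -
  let ?c = "init_config xs"
  \<comment> \<open>Brings the program counter \<open>Suc (Suc 0)\<close> into the form expected by
    \<open>prog_nth\<close>.\<close>
  note [simp] = numeral_2_eq_2 [symmetric]
  have [simp]: "pc ?c = 0" "ireg ?c 0 = length xs" "ireg ?c 9 = 0"
    by (simp_all add: init_config_def)
  have sum: "sum_mset (mset xs) = (\<Sum>q<length xs. rarr ?c 0 q)"
    by (simp add: init_config_def sum_mset_sum_list sum_list_sum_nth atLeast0LessThan)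
  have items: "reach (prog K)
    (\<lambda>t c. t = 6 * length xs + 5 \<and> pc c = 10 \<and> ireg c 1 = 1 \<and> ireg c 2 = K \<and>
       ireg c 3 = length xs \<and> ireg c 9 = 0 \<and> rreg c 1 = sum_mset (mset xs) \<and> rarr c = rarr ?c \<and>
       iarr c = (iarr ?c)(0 := \<lambda>q. if q < length xs then 1 else iarr ?c 0 q)) ?c"
    apply (rule reach_next, simp, simp, simp)+
    apply (rule reach_mono, rule item_loop[where k = "length xs"])
        apply (simp_all add: sum)
    apply (simp add: init_config_def fun_eq_iff)
    done
  show ?thesis
  proof (rule reach_trans[OF items])
    fix t :: nat and c :: config
    assume "t = 6 * length xs + 5 \<and> pc c = 10 \<and> ireg c 1 = 1 \<and> ireg c 2 = K \<and>
       ireg c 3 = length xs \<and> ireg c 9 = 0 \<and> rreg c 1 = sum_mset (mset xs) \<and> rarr c = rarr ?c \<and>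
       iarr c = (iarr ?c)(0 := \<lambda>q. if q < length xs then 1 else iarr ?c 0 q)"
    then have t: "t = 6 * length xs + 5" and [simp]: "pc c = 10" "ireg c 1 = 1" "ireg c 2 = K"
      "ireg c 3 = length xs" "ireg c 9 = 0" "rreg c 1 = sum_mset (mset xs)"
      and arr: "rarr c = rarr ?c" "\<forall>q<length xs. iarr c 0 q = 1"
      by simp_all
    note it = items_all_one[OF arr(2)]
    \<comment> \<open>Both gap conditions are vacuous: no position lies beyond the pointer and no
      item is outside set 1.\<close>
    have "frontier K xs (iarr c 0) (length xs)"
      using arr(2) assms by (auto simp: frontier_def)
    then show "reach (prog K) (\<lambda>t' c'. t + t' = 6 * length xs + 4 * K + 9 \<and> pc c' = 17 \<and>
        layout K xs {1..K} c' \<and> ireg c' 3 = length xs \<and> (\<forall>q<length xs. iarr c' 0 q = 1)) c"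
      apply -
      apply (rule reach_next, simp, simp, simp)+
      apply (rule reach_trans, rule index_loop[where k = K], simp, simp, simp, simp)
      apply (rule reach_next, simp, simp, simp)
      apply (rule reach_refl)
      using assms t arr it
      apply (auto simp: layout_def set_sum_def init_config_def)
      done
  qed
qed

theorem theorem2:
  fixes K :: nat
  assumes "K \<ge> 2"
  shows "\<exists>(P :: program) (T :: nat \<Rightarrow> nat).
           (\<forall>xs :: real list. sorted xs \<and> (\<forall>x \<in> set xs. 0 < x) \<longrightarrow>
              implements_within P K xs (T (length xs))) \<and>
           (\<lambda>N. real (T N)) \<in> O(\<lambda>N. real N * ln (real N))"
proof (intro exI conjI allI impI)
  \<comment> \<open>Initialization time plus the main loop bound at the initial potential
    \<open>N + K\<close>; for fixed \<open>K\<close> this is linear in \<open>N\<close>.\<close>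
  let ?T = "\<lambda>N. 6 * N + 4 * K + 9 + ((12 * K + 19) * (N + K) + 1)"
  fix xs :: "real list"
  assume xs: "sorted xs \<and> (\<forall>x \<in> set xs. 0 < x)"
  have "reach (prog K)
    (\<lambda>t c. t = 6 * length xs + 4 * K + 9 \<and> pc c = 17 \<and> layout K xs {1..K} c \<and>
       ireg c 3 = length xs \<and> (\<forall>q<length xs. iarr c 0 q = 1)) (init_config xs)"
    using assms by (intro init_block) simp
  then obtain t c where c: "c = (ram_step (prog K) ^^ t) (init_config xs)"
    and t: "t = 6 * length xs + 4 * K + 9" and "pc c = 17" "layout K xs {1..K} c"
    and p: "ireg c 3 = length xs" and one: "\<forall>q<length xs. iarr c 0 q = 1"
    unfolding reach_def by blast
  then have "runs (prog K) K xs (items xs (iarr c 0), {1..K}) c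
      ((12 * K + 19) * (ireg c 3 + card {1..K}) + 1)"
    using xs by (intro runs_main_loop) simp_all
  moreover have "(items xs (iarr c 0), {1..K}) = init_state K xs"
    by (simp add: items_all_one[OF one] init_state_def)
  ultimately have "runs (prog K) K xs (init_state K xs) c ((12 * K + 19) * (length xs + K) + 1)"
    by (simp add: p)
  then show "implements_within (prog K) K xs (?T (length xs))"
    unfolding runs_init_iff_implements[symmetric] t[symmetric] c by (rule runs_delay)
next
  let ?T = "\<lambda>N. 6 * N + 4 * K + 9 + ((12 * K + 19) * (N + K) + 1)"
  show "(\<lambda>N. real (?T N)) \<in> O(\<lambda>N. real N * ln (real N))"
  \<comment> \<open>As \<open>?T\<close> is affine with natural coefficients, \<open>?T N\<close> is
    at most \<open>?T 1 * N\<close> for positive \<open>N\<close>; from 3 on, \<open>N\<close>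
    exceeds \<open>exp 1\<close>, so \<open>ln N\<close> is at least 1.\<close>
  proof (rule bigoI[where c = "real (?T 1)"], rule eventually_sequentiallyI[of 3])
    fix N :: nat
    assume N: "3 \<le> N"
    have "?T N \<le> ?T 1 * N"
    proof -
      define a b where "a = 4 * K + 10 + (12 * K + 19) * K" and "b = 12 * K + 25"
      have T: "?T M = a + b * M" for M
        by (simp add: a_def b_def algebra_simps)
      have "a + b * N \<le> a * N + b * N"
        using N by simp
      then show ?thesis
        unfolding T by (simp add: distrib_right)
    qed
    then have "real (?T N) \<le> real (?T 1) * real N"
      by (metis of_nat_le_iff of_nat_mult)
    also have "\<dots> \<le> real (?T 1) * (real N * ln (real N))"
    proof -
      have "exp 1 \<le> real N"
        using exp_le N by linarith
      then have "1 \<le> ln (real N)"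
        using N by (subst ln_ge_iff) simp_all
      then show ?thesis
        using mult_left_mono[of 1 "ln (real N)" "real N"] by (intro mult_left_mono) simp_all
    qed
    finally show "norm (real (?T N)) \<le> real (?T 1) * norm (real N * ln (real N))"
      using N by (simp add: abs_mult)
  qed
qed

end
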